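(* Let $m\ge1$ and let $\hat\Theta$ be a solution of the dual problem $\min\{J(\Theta):\Theta\in\mathcal{D}_T\}$, where $J(\Theta)=\mathrm{tr}\int\log(\Psi^{-1}+G^*\Theta G)^{-1}+\mathrm{tr}(\hat\Sigma\Theta)$. For $\Theta\in\mathcal{D}_T$ let $L_\Theta$ be such that $\mathcal{T}_{\Theta,1}=L_\Theta L_\Theta^*$, and let $\Lambda_\Theta=L_\Theta^{-1}\Omega L_\Theta^{-*}$ be the spectral density of the normalized one-step-ahead prediction error when the actual process has spectral density $\Omega$ and the predictor is based on the model $\mathcal{T}_{\Theta,1}$. Then $\hat\Theta$ solves the prediction error identification problem $$\hat\Theta=\mathrm{argmin}_{\Theta\in\mathcal{D}_T}\ \mathcal{S}_{IS}(\Lambda_\Theta\|I).$$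
   Context: $\mathcal{S}_m^+$ is the set of $m\times m$ spectral densities of $\mathbb{R}^m$-valued stationary processes (Hermitian positive semidefinite functions on the unit circle, with $\Phi(e^{-i\vartheta})=\overline{\Phi(e^{i\vartheta})}$) that are bounded and coercive ($k_1I\preceq\Phi\preceq k_2I$ for some $k_1,k_2>0$). $\mathcal{Q}_n$ is the space of real symmetric $n\times n$ matrices. $\int$ is integration over the unit circle with respect to normalized Lebesgue measure; $*$ is conjugate transpose on the unit circle; inequalities between functions hold on the whole unit circle. Setting: $G(z)=(zI-A)^{-1}B$ with $A\in\mathbb{R}^{n\times n}$ having all eigenvalues in the open unit disc, $B\in\mathbb{R}^{n\times m}$, $n>m$, $(A,B)$ reachable. $\Psi\in\mathcal{S}_m^+$ is a prior spectral density of bounded McMillan degree (rational), with left square spectral factor $W_\Psi$, $\Psi=W_\Psi W_\Psi^*$. $\Omega\succ0$ is the (possibly truncated by the Blackman-Tukey method) biased correlogram computed from data $\mathrm{y}(1),\dots,\mathrm{y}(N)\in\mathbb{R}^m$ (a trigonometric matrix polynomial, so $\Omega\in\mathcal{S}_m^+$), and $\hat\Sigma=\int G\Omega G^*$. $\mathcal{D}_T=\{\Theta\in\mathcal{Q}_n:I+W_\Psi^*G^*\Theta GW_\Psi\succ0\}$ and $\mathcal{T}_{\Theta,1}=W_\Psi(I+W_\Psi^*G^*\Theta GW_\Psi)^{-1}W_\Psi^*$ (which equals $(\Psi^{-1}+G^*\Theta G)^{-1}$). $L_\Theta$ is $m\times m$, the Fourier transform of the impulse response of the shaping filter of the model (driven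 by the normalized innovation, white Gaussian noise with identity variance). The prediction error identification method selects the parameter minimizing a nonnegative cost $V(\Theta,\mathrm{y})$ that is a function of the normalized prediction error of the model with parameter $\Theta$; here $V(\Theta,\mathrm{y})=\mathcal{S}_{IS}(\Lambda_\Theta\|I)$, where the Itakura-Saito distance is $\mathcal{S}_{IS}(\Phi_1\|\Phi_2)=\mathrm{tr}\int[\log\Phi_2-\log\Phi_1+\Phi_1\Phi_2^{-1}-I]$. *)

theory Defs
  imports "HOL-Analysis.Analysis"
begin

text \<open>
  Functions on the unit circle are represented by functions on the complex plane that are
  only ever constrained and evaluated on the unit circle \<open>sphere 0 1\<close>.
\<close>

section \<open>Complex matrices\<close>

abbreviation cmat :: "real^'a^'b \<Rightarrow> complex^'a^'b" where
  "cmat \<equiv> map_matrix complex_of_real"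

definition conjtr :: "complex^'a^'b \<Rightarrow> complex^'b^'a" where
  "conjtr M = transpose (map_matrix cnj M)"

definition hermitian :: "complex^'a^'a \<Rightarrow> bool" where
  "hermitian M \<longleftrightarrow> conjtr M = M"

definition quad_form :: "complex^'a^'a \<Rightarrow> complex^'a \<Rightarrow> complex" where
  "quad_form M x = (\<Sum>i\<in>UNIV. cnj (x $ i) * (M *v x) $ i)"

definition pos_def :: "complex^'a^'a \<Rightarrow> bool" where
  "pos_def M \<longleftrightarrow> hermitian M \<and> (\<forall>x. x \<noteq> 0 \<longrightarrow> 0 < Re (quad_form M x))"

definition pos_semidef :: "complex^'a^'a \<Rightarrow> bool" where
  "pos_semidef M \<longleftrightarrow> hermitian M \<and> (\<forall>x. 0 \<le> Re (quad_form M x))"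

definition loewner_le :: "complex^'a^'a \<Rightarrow> complex^'a^'a \<Rightarrow> bool" where
  "loewner_le M N \<longleftrightarrow> pos_semidef (N - M)"

definition unitary :: "complex^'a^'a \<Rightarrow> bool" where
  "unitary U \<longleftrightarrow> U ** conjtr U = mat 1 \<and> conjtr U ** U = mat 1"

definition real_diag :: "('a \<Rightarrow> real) \<Rightarrow> complex^'a^'a" where
  "real_diag d = (\<chi> i j. if i = j then complex_of_real (d i) else 0)"

text \<open>
  Logarithm of a Hermitian positive definite matrix, through its spectral decomposition
  (the result does not depend on the decomposition chosen).
\<close>
definition mat_log :: "complex^'a^'a \<Rightarrow> complex^'a^'a" where
  "mat_log M = (THE X. \<exists>U d. unitary U \<and> (\<forall>i. 0 < d i) \<and>
      M = U ** real_diag d ** conjtr U \<and>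
      X = U ** real_diag (\<lambda>i. ln (d i)) ** conjtr U)"

text \<open>Integral over the unit circle with respect to normalized Lebesgue measure.\<close>
definition circle_integral :: "(complex \<Rightarrow> complex^'a^'b) \<Rightarrow> complex^'a^'b" where
  "circle_integral F = (1 / (2 * pi)) *\<^sub>R (LINT \<theta>:{-pi..pi}|lborel. F (cis \<theta>))"

section \<open>Spectral densities and spectral factors\<close>

definition S_plus :: "(complex \<Rightarrow> complex^'m^'m) set" where
  "S_plus = {\<Phi>. (\<lambda>\<theta>. \<Phi> (cis \<theta>)) \<in> borel_measurable borel \<and>
     (\<forall>z\<in>sphere 0 1. pos_semidef (\<Phi> z) \<and> \<Phi> (cnj z) = map_matrix cnj (\<Phi> z)) \<and>
     (\<exists>k1>0. \<exists>k2>0. \<forall>z\<in>sphere 0 1.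
        loewner_le (cmat (mat k1)) (\<Phi> z) \<and> loewner_le (\<Phi> z) (cmat (mat k2)))}"

definition rational_on_circle :: "(complex \<Rightarrow> complex^'a^'b) \<Rightarrow> bool" where
  "rational_on_circle F \<longleftrightarrow> (\<forall>i j. \<exists>p q :: complex poly. \<forall>z\<in>sphere 0 1.
     poly q z \<noteq> 0 \<and> F z $ i $ j = poly p z / poly q z)"

definition left_spectral_factor ::
  "(complex \<Rightarrow> complex^'m^'m) \<Rightarrow> (complex \<Rightarrow> complex^'m^'m) \<Rightarrow> bool" where
  "left_spectral_factor W \<Phi> \<longleftrightarrow> (\<forall>z\<in>sphere 0 1. \<Phi> z = W z ** conjtr (W z))"

text \<open>
  Fourier transform of a real, causal, absolutely summable impulse response \<open>h\<close>; since \<open>z\<close> is the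
  forward shift, \<open>h k\<close> multiplies \<open>z\<close> to the power \<open>-k\<close>.
\<close>
definition stable_causal :: "(complex \<Rightarrow> complex^'m^'m) \<Rightarrow> bool" where
  "stable_causal F \<longleftrightarrow> (\<exists>h :: nat \<Rightarrow> real^'m^'m. summable (\<lambda>k. norm (h k)) \<and>
     (\<forall>z\<in>sphere 0 1. (\<lambda>k. mat (inverse z ^ k) ** cmat (h k)) sums F z))"

text \<open>
  Shaping filter of a process with spectral density \<open>\<Phi>\<close>, driven by the normalized innovation:
  a left square spectral factor which is causal, and causally invertible, so that its input
  (white, with identity variance) is a causal function of the process, i.e. its innovation.
\<close>
definition shaping_filter ::
  "(complex \<Rightarrow> complex^'m^'m) \<Rightarrow> (complex \<Rightarrow> complex^'m^'m) \<Rightarrow> bool" where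
  "shaping_filter L \<Phi> \<longleftrightarrow> left_spectral_factor L \<Phi> \<and>
     stable_causal L \<and> stable_causal (\<lambda>z. matrix_inv (L z))"

text \<open>
  Spectral density of the normalized one-step-ahead prediction error (the process filtered by
  the inverse of \<open>L\<close>) when the process has spectral density \<open>\<Omega>\<close> and the predictor is based on the
  model with shaping filter \<open>L\<close>.
\<close>
definition pred_error_density ::
  "(complex \<Rightarrow> complex^'m^'m) \<Rightarrow> (complex \<Rightarrow> complex^'m^'m) \<Rightarrow> complex \<Rightarrow> complex^'m^'m" where
  "pred_error_density L \<Omega> z = matrix_inv (L z) ** \<Omega> z ** conjtr (matrix_inv (L z))"

text \<open>The trace is real for spectral densities; \<open>Re\<close> only changes the type.\<close>
definition itakura_saito ::
  "(complex \<Rightarrow> complex^'m^'m) \<Rightarrow> (complex \<Rightarrow> complex^'m^'m) \<Rightarrow> real" where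
  "itakura_saito \<Phi>1 \<Phi>2 = Re (trace (circle_integral
     (\<lambda>z. mat_log (\<Phi>2 z) - mat_log (\<Phi>1 z) + \<Phi>1 z ** matrix_inv (\<Phi>2 z) - mat 1)))"

section \<open>Correlogram\<close>

text \<open>Biased sample covariance lags of the data \<open>y 1, \<dots>, y N\<close>, for nonnegative lag and for any lag.\<close>
definition sample_cov :: "nat \<Rightarrow> (nat \<Rightarrow> real^'m) \<Rightarrow> nat \<Rightarrow> real^'m^'m" where
  "sample_cov N y k = (1 / real N) *\<^sub>R (\<Sum>t = 1..N - k. \<chi> i j. y (t + k) $ i * y t $ j)"

definition sample_cov_int :: "nat \<Rightarrow> (nat \<Rightarrow> real^'m) \<Rightarrow> int \<Rightarrow> real^'m^'m" where
  "sample_cov_int N y k =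
     (if 0 \<le> k then sample_cov N y (nat k) else transpose (sample_cov N y (nat (- k))))"

text \<open>
  Blackman-Tukey truncation at lag \<open>M \<le> N\<close> with (even) lag window \<open>w\<close>, \<open>w 0 = 1\<close>. The untruncated
  biased correlogram is the case \<open>M = N\<close>, \<open>w = (\<lambda>_. 1)\<close>.
\<close>
definition correlogram ::
  "nat \<Rightarrow> nat \<Rightarrow> (nat \<Rightarrow> real) \<Rightarrow> (nat \<Rightarrow> real^'m) \<Rightarrow> complex \<Rightarrow> complex^'m^'m" where
  "correlogram N M w y z = (\<Sum>k \<in> {- (int M - 1) .. int M - 1}.
     mat (complex_of_real (w (nat \<bar>k\<bar>)) * z powi (- k)) ** cmat (sample_cov_int N y k))"

section \<open>The filter bank and the dual problem\<close>

definition schur_stable :: "real^'n^'n \<Rightarrow> bool" where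
  "schur_stable A \<longleftrightarrow>
     (\<forall>(c::complex) v. v \<noteq> 0 \<and> cmat A *v v = c *s v \<longrightarrow> cmod c < 1)"

text \<open>The reachability matrix, with block columns \<open>A\<^sup>k B\<close> for \<open>k < n\<close>, has full row rank.\<close>
definition reachable :: "real^'n^'n \<Rightarrow> real^'m^'n \<Rightarrow> bool" where
  "reachable A B \<longleftrightarrow>
     span (\<Union>k<CARD('n). columns ((((**) A) ^^ k) B)) = (UNIV :: (real^'n) set)"

definition filter_bank :: "real^'n^'n \<Rightarrow> real^'m^'n \<Rightarrow> complex \<Rightarrow> complex^'m^'n" where
  "filter_bank A B z = matrix_inv (mat z - cmat A) ** cmat B"

definition D_T ::
  "(complex \<Rightarrow> complex^'m^'n) \<Rightarrow> (complex \<Rightarrow> complex^'m^'m) \<Rightarrow> (real^'n^'n) set" where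
  "D_T G W = {\<Theta>. transpose \<Theta> = \<Theta> \<and> (\<forall>z\<in>sphere 0 1.
     pos_def (mat 1 + conjtr (W z) ** conjtr (G z) ** cmat \<Theta> ** G z ** W z))}"

definition T_model ::
  "(complex \<Rightarrow> complex^'m^'n) \<Rightarrow> (complex \<Rightarrow> complex^'m^'m) \<Rightarrow> real^'n^'n
     \<Rightarrow> complex \<Rightarrow> complex^'m^'m" where
  "T_model G W \<Theta> z =
     W z ** matrix_inv (mat 1 + conjtr (W z) ** conjtr (G z) ** cmat \<Theta> ** G z ** W z)
       ** conjtr (W z)"

definition state_cov ::
  "(complex \<Rightarrow> complex^'m^'n) \<Rightarrow> (complex \<Rightarrow> complex^'m^'m) \<Rightarrow> complex^'n^'n" where
  "state_cov G \<Omega> = circle_integral (\<lambda>z. G z ** \<Omega> z ** conjtr (G z))"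

definition dual_cost ::
  "(complex \<Rightarrow> complex^'m^'n) \<Rightarrow> (complex \<Rightarrow> complex^'m^'m) \<Rightarrow> complex^'n^'n
     \<Rightarrow> real^'n^'n \<Rightarrow> real" where
  "dual_cost G \<Psi> \<Sigma> \<Theta> =
     Re (trace (circle_integral (\<lambda>z.
        mat_log (matrix_inv (matrix_inv (\<Psi> z) + conjtr (G z) ** cmat \<Theta> ** G z)))))
     + Re (trace (\<Sigma> ** cmat \<Theta>))"

end

theory Submission
  imports Defs
begin

text \<open>
  On the feasible set the two costs differ by a constant, so they have the same minimisers. Fix a
  point of the unit circle and a feasible \<open>\<Theta>\<close>, and write \<open>T = L L\<^sup>*\<close> for the model and
  \<open>\<Lambda> = L\<^sup>-\<^sup>1 \<Omega> L\<^sup>-\<^sup>*\<close> for the prediction error density. The trace of the matrix logarithm is the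
  logarithm of the determinant (\<open>trace_mat_log\<close>), which is multiplicative, and the trace is cyclic.
  Since \<open>T\<^sup>-\<^sup>1 = \<Psi>\<^sup>-\<^sup>1 + G\<^sup>* \<Theta> G\<close> (\<open>model_inverse\<close>), this gives (\<open>prediction_error_identity\<close>)
  \<open>tr (\<Lambda> - log \<Lambda>) = tr (log T) + tr (\<Omega> G\<^sup>* \<Theta> G) + tr (\<Omega> \<Psi>\<^sup>-\<^sup>1 - log \<Omega>)\<close>.
  The last term is independent of \<open>\<Theta>\<close> and the others integrate to the dual cost
  (\<open>itakura_saito_eq_dual_cost\<close>).

  The analytic point is that the integrals may be split and exchanged with the trace, for which
  the integrands of both costs are shown to be continuous on the circle. Shaping filters are
  continuous as uniform limits of their Fourier series and the filter bank is continuous by Cramer's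
  rule. Continuity of the logarithm (\<open>continuous_on_mat_log\<close>) is obtained from the spectral theorem,
  proved here with Rayleigh quotients, by viewing the matrices with spectrum in a compact
  interval as a quotient of the compact set of their spectral decompositions.
\<close>

section \<open>Matrix algebra\<close>

lemma matrix_inv_eqI:
  fixes M N :: "complex^'a^'a"
  assumes "M ** N = mat 1"
  shows "matrix_inv M = N"
proof -
  have NM: "N ** M = mat 1"
    using assms matrix_left_right_inverse by blast
  have "M ** matrix_inv M = mat 1 \<and> matrix_inv M ** M = mat 1"
    unfolding matrix_inv_def by (rule someI[of _ N]) (simp add: assms NM)
  then have "N ** (M ** matrix_inv M) = N" by simp
  then show ?thesis by (simp add: matrix_mul_assoc NM)
qed

lemma matrix_inv_right_left:
  fixes M :: "complex^'a^'a"
  assumes "invertible M"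
  shows "M ** matrix_inv M = mat 1" "matrix_inv M ** M = mat 1"
  using assms matrix_inv_eqI unfolding invertible_def by metis+

lemma matrix_add_rdistrib: "(M + N) ** P = M ** P + N ** P"
  by (simp add: vec_eq_iff matrix_matrix_mult_def distrib_right sum.distrib)

lemma invertible_of_mult:
  fixes M N :: "complex^'a^'a"
  assumes "invertible (M ** N)"
  shows "invertible M"
  using assms by (metis det_mul invertible_det_nz mult_zero_left)

lemma conjtr_nth [simp]: "conjtr M $ i $ j = cnj (M $ j $ i)"
  by (simp add: conjtr_def transpose_def)

lemma conjtr_conjtr [simp]: "conjtr (conjtr M) = M"
  by (simp add: vec_eq_iff)

lemma conjtr_mat_1 [simp]: "conjtr (mat 1) = mat 1"
  by (simp add: vec_eq_iff mat_def)

lemma conjtr_mult: "conjtr (M ** N) = conjtr N ** conjtr M"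
  by (simp add: vec_eq_iff matrix_matrix_mult_def mult.commute)

definition herm_prod :: "complex^'a \<Rightarrow> complex^'a \<Rightarrow> complex" where
  "herm_prod x y = (\<Sum>i\<in>UNIV. cnj (x $ i) * y $ i)"

lemma Re_herm_prod: "Re (herm_prod x y) = x \<bullet> y"
  by (simp add: herm_prod_def inner_vec_def inner_complex_def)

lemma herm_prod_self: "herm_prod x x = complex_of_real ((norm x)\<^sup>2)"
proof (rule complex_eqI)
  show "Re (herm_prod x x) = Re (complex_of_real ((norm x)\<^sup>2))"
    by (simp add: Re_herm_prod dot_square_norm)
qed (simp add: herm_prod_def mult.commute)

lemma herm_prod_adjoint: "herm_prod x (M *v y) = herm_prod (conjtr M *v x) y"
proof -
  have "herm_prod x (M *v y) = (\<Sum>i\<in>UNIV. \<Sum>j\<in>UNIV. cnj (x $ i) * (M $ i $ j * y $ j))"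
    by (simp add: herm_prod_def matrix_vector_mult_def sum_distrib_left)
  also have "\<dots> = (\<Sum>j\<in>UNIV. \<Sum>i\<in>UNIV. cnj (x $ i) * (M $ i $ j * y $ j))"
    by (rule sum.swap)
  also have "\<dots> = herm_prod (conjtr M *v x) y"
    by (simp add: herm_prod_def matrix_vector_mult_def sum_distrib_left sum_distrib_right mult_ac)
  finally show ?thesis .
qed

lemma herm_prod_scale [simp]:
  "herm_prod x (c *s y) = c * herm_prod x y"
  "herm_prod (c *s x) y = cnj c * herm_prod x y"
  by (simp_all add: herm_prod_def sum_distrib_left mult_ac)

lemma herm_prod_add: "herm_prod x (y + z) = herm_prod x y + herm_prod x z"
  by (simp add: herm_prod_def distrib_left sum.distrib)

lemma herm_prod_scaleR: "herm_prod x (r *\<^sub>R y) = r *\<^sub>R herm_prod x y"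
  by (simp add: herm_prod_def scaleR_sum_right)

lemma herm_prod_zero [simp]: "herm_prod x 0 = 0"
  by (simp add: herm_prod_def)

lemma herm_prod_cnj: "cnj (herm_prod x y) = herm_prod y x"
  by (simp add: herm_prod_def mult.commute)

lemma Re_quad_form: "Re (quad_form M x) = x \<bullet> (M *v x)"
  by (simp add: quad_form_def herm_prod_def[symmetric] Re_herm_prod)

lemma hermitian_inner:
  assumes "hermitian M"
  shows "x \<bullet> (M *v y) = (M *v x) \<bullet> y"
  using assms herm_prod_adjoint[of x M y] unfolding hermitian_def
  by (metis Re_herm_prod)

lemma scaleR_matrix_vector: "(M :: complex^'a^'b) *v (r *\<^sub>R x) = r *\<^sub>R (M *v x)"
  by (simp add: matrix_vector_mult_def vec_eq_iff scaleR_sum_right)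

lemma pos_def_invertible:
  assumes "pos_def M"
  shows "invertible M"
proof -
  have "x = 0" if "M *v x = 0" for x
    using assms that unfolding pos_def_def Re_quad_form by fastforce
  then show ?thesis
    unfolding invertible_left_inverse matrix_left_invertible_ker by blast
qed

lemma pos_def_mat_1: "pos_def (mat 1 :: complex^'a^'a)"
  by (simp add: pos_def_def hermitian_def Re_quad_form)

lemma pos_def_congruence:
  fixes P M :: "complex^'a^'a"
  assumes "pos_def M" "invertible P"
  shows "pos_def (P ** M ** conjtr P)"
proof -
  have inv: "conjtr (matrix_inv P) ** conjtr P = mat 1"
    using matrix_inv_right_left[OF assms(2)] by (simp flip: conjtr_mult)
  have "0 < x \<bullet> ((P ** M ** conjtr P) *v x)" if "x \<noteq> 0" for x
  proof -
    have "conjtr P *v x \<noteq> 0"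
      using that inv matrix_left_invertible_ker by blast
    then have "0 < (conjtr P *v x) \<bullet> (M *v (conjtr P *v x))"
      using assms(1) by (simp add: pos_def_def Re_quad_form)
    also have "\<dots> = Re (herm_prod x (P *v (M *v (conjtr P *v x))))"
      by (simp add: herm_prod_adjoint[of x P] Re_herm_prod)
    finally show ?thesis
      by (simp add: Re_herm_prod matrix_vector_mul_assoc matrix_mul_assoc)
  qed
  then show ?thesis
    using assms(1) by (simp add: pos_def_def Re_quad_form hermitian_def conjtr_mult matrix_mul_assoc)
qed

section \<open>Spectral theorem for Hermitian matrices\<close>

text \<open>
  The eigenvector is a maximiser \<open>v\<close> of the Rayleigh quotient, with maximum \<open>\<lambda>\<close>. The quadratic form
  of \<open>\<lambda> - M\<close> is nonnegative on the subspace and vanishes at \<open>v\<close>, so its derivative at \<open>v\<close> in the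
  direction \<open>\<lambda> v - M v\<close>, which is twice the squared length of that vector, vanishes.
\<close>
lemma eigenvector_in_invariant_subspace:
  fixes M :: "complex^'a^'a"
  assumes herm: "hermitian M" and V: "subspace V" and inv: "\<And>x. x \<in> V \<Longrightarrow> M *v x \<in> V"
    and u: "u \<in> V" "u \<noteq> 0"
  obtains v l where "v \<in> V" "norm v = 1" "M *v v = complex_of_real l *s v"
proof -
  let ?S = "V \<inter> sphere 0 1"
  have "compact ?S"
    using closed_subspace[OF V] by (simp add: closed_Int_compact)
  moreover have "(1 / norm u) *\<^sub>R u \<in> ?S"
    using u V by (simp add: subspace_scale)
  then have "?S \<noteq> {}" by blast
  moreover have "continuous_on ?S (\<lambda>x. x \<bullet> (M *v x))"
    unfolding matrix_vector_mult_def by (intro continuous_intros)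
  ultimately obtain v where "v \<in> ?S" and max_S: "\<forall>x\<in>?S. x \<bullet> (M *v x) \<le> v \<bullet> (M *v v)"
    using continuous_attains_sup[of ?S "\<lambda>x. x \<bullet> (M *v x)"] by blast
  then have v: "v \<in> V" "norm v = 1" by auto
  have max: "x \<bullet> (M *v x) \<le> v \<bullet> (M *v v)" if "x \<in> V" "norm x = 1" for x
    using max_S that by simp
  define l where "l = v \<bullet> (M *v v)"
  define q where "q x = l * (x \<bullet> x) - x \<bullet> (M *v x)" for x
  have q_nonneg: "0 \<le> q x" if "x \<in> V" for x
  proof (cases "x = 0")
    case False
    let ?y = "(1 / norm x) *\<^sub>R x"
    have "?y \<bullet> (M *v ?y) \<le> l"
      unfolding l_def using False that V by (intro max) (simp_all add: subspace_scale)
    then have "(x \<bullet> (M *v x)) / (norm x)\<^sup>2 \<le> l"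
      by (simp add: scaleR_matrix_vector power2_eq_square)
    then show ?thesis
      using False by (simp add: q_def divide_le_eq dot_square_norm)
  qed (simp add: q_def)
  define w where "w = l *\<^sub>R v - M *v v"
  have w: "w \<in> V"
    using V v inv unfolding w_def by (simp add: subspace_diff subspace_scale)
  have wv: "l * (w \<bullet> v) - w \<bullet> (M *v v) = w \<bullet> w"
    by (simp add: w_def inner_diff_right)
  have "q v = 0"
    using v by (simp add: q_def l_def dot_square_norm)
  have expand: "q (v + t *\<^sub>R w) = 2 * t * (w \<bullet> w) + t\<^sup>2 * q w" for t
  proof -
    have "v \<bullet> (M *v w) = w \<bullet> (M *v v)"
      using hermitian_inner[OF herm] by (metis inner_commute)
    then have "q (v + t *\<^sub>R w) = q v + 2 * t * (l * (w \<bullet> v) - w \<bullet> (M *v v)) + t\<^sup>2 * q w"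
      by (simp add: q_def matrix_vector_right_distrib scaleR_matrix_vector inner_add_left
          inner_add_right inner_commute[of v w] power2_eq_square algebra_simps)
    then show ?thesis by (simp add: wv \<open>q v = 0\<close>)
  qed
  define a b where "a = w \<bullet> w" and "b = q w"
  have "0 \<le> b" using q_nonneg[OF w] by (simp add: b_def)
  have "a = 0"
  proof (rule ccontr)
    assume "a \<noteq> 0"
    let ?t = "- a / (b + 1)"
    have "0 \<le> q (v + ?t *\<^sub>R w)"
      using V v w by (intro q_nonneg subspace_add subspace_scale)
    also have "\<dots> = 2 * ?t * a + ?t\<^sup>2 * b"
      by (simp only: expand a_def b_def)
    also have "\<dots> = - (a\<^sup>2 * (b + 2) / (b + 1)\<^sup>2)"
      using \<open>0 \<le> b\<close> by (simp add: divide_simps power2_eq_square) (simp add: algebra_simps)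
    also have "\<dots> < 0"
      using \<open>0 \<le> b\<close> \<open>a \<noteq> 0\<close> by simp
    finally show False by simp
  qed
  then have "M *v v = l *\<^sub>R v" by (simp add: a_def w_def)
  also have "\<dots> = complex_of_real l *s v"
    by (simp only: vec_eq_iff vector_scaleR_component vector_smult_component)
      (simp add: scaleR_conv_of_real)
  finally show thesis using that v by blast
qed

text \<open>
  The induction adds one eigenvector at a time, from the orthogonal complement of those already
  found. The complement is nonzero because it is the kernel of a square matrix with a zero row.
\<close>
lemma orthonormal_eigenvectors:
  fixes M :: "complex^'a^'a" and S :: "'a set"
  assumes herm: "hermitian M"
  shows "\<exists>(u :: 'a \<Rightarrow> complex^'a) d. (\<forall>i\<in>S. \<forall>j\<in>S. herm_prod (u i) (u j) = (if i = j then 1 else 0)) \<and>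
    (\<forall>i\<in>S. M *v u i = complex_of_real (d i) *s u i)"
  using finite[of S]
proof (induction S rule: finite_induct)
  case empty
  then show ?case by simp
next
  case (insert k S)
  then obtain u :: "'a \<Rightarrow> complex^'a" and d :: "'a \<Rightarrow> real"
    where orth: "\<forall>i\<in>S. \<forall>j\<in>S. herm_prod (u i) (u j) = (if i = j then 1 else 0)"
      and eig: "\<forall>i\<in>S. M *v u i = complex_of_real (d i) *s u i" by blast
  define V where "V = {x. \<forall>i\<in>S. herm_prod (u i) x = 0}"
  define N :: "complex^'a^'a" where "N = (\<chi> i j. if i \<in> S then cnj (u i $ j) else 0)"
  have "row k N = 0"
    using insert by (simp add: N_def row_def vec_eq_iff)
  then have "\<not> invertible N"
    by (simp add: invertible_det_nz det_zero_row)
  then obtain x where x: "x \<noteq> 0" "N *v x = 0"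
    unfolding invertible_left_inverse matrix_left_invertible_ker by blast
  have "herm_prod (u i) x = (N *v x) $ i" if "i \<in> S" for i
    using that by (simp add: N_def herm_prod_def matrix_vector_mult_def)
  then have "x \<in> V" using x by (simp add: V_def)
  have "subspace V"
    by (simp add: subspace_def V_def herm_prod_add herm_prod_scaleR)
  have inv: "M *v y \<in> V" if "y \<in> V" for y
    using that herm eig by (simp add: V_def herm_prod_adjoint hermitian_def)
  obtain v l where v: "v \<in> V" "norm v = 1" "M *v v = complex_of_real l *s v"
    using eigenvector_in_invariant_subspace[OF herm \<open>subspace V\<close> inv \<open>x \<in> V\<close> x(1)] .
  have vu: "herm_prod (u i) v = 0" "herm_prod v (u i) = 0" if "i \<in> S" for i
    using v(1) that herm_prod_cnj[of "u i" v] by (auto simp: V_def)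
  have "herm_prod v v = 1" by (simp add: herm_prod_self v)
  then show ?case
    using orth eig v vu insert(2)
    by (intro exI[of _ "u(k := v)"] exI[of _ "d(k := l)"]) auto
qed

lemma mult_real_diag_nth [simp]:
  "(M ** real_diag d) $ i $ j = M $ i $ j * complex_of_real (d j)"
  "(real_diag d ** M) $ i $ j = complex_of_real (d i) * M $ i $ j"
  by (simp_all add: matrix_matrix_mult_def real_diag_def if_distrib if_distribR
      sum.delta' cong: if_cong)

lemma column_quad_form:
  assumes "unitary U" "M = U ** real_diag d ** conjtr U"
  shows "column i U \<bullet> (M *v column i U) = d i" "norm (column i U) = 1"
proof -
  have UU: "conjtr U ** U = mat 1" using assms by (simp add: unitary_def)
  then have "M ** U = U ** real_diag d"
    unfolding assms(2) by (simp flip: matrix_mul_assoc)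
  then have "(M ** U) $ j $ i = U $ j $ i * complex_of_real (d i)" for j by simp
  then have eig: "M *v column i U = complex_of_real (d i) *s column i U"
    by (simp add: vec_eq_iff matrix_vector_mult_def matrix_matrix_mult_def column_def mult.commute)
  have "herm_prod (column i U) (column i U) = (conjtr U ** U) $ i $ i"
    by (simp add: herm_prod_def column_def matrix_matrix_mult_def)
  then have one: "herm_prod (column i U) (column i U) = 1"
    by (simp add: UU mat_def)
  then have "complex_of_real ((norm (column i U))\<^sup>2) = complex_of_real 1"
    by (simp add: herm_prod_self)
  then show "norm (column i U) = 1"
    by (simp only: of_real_eq_iff) (simp add: power2_eq_iff_nonneg[of _ 1, simplified])
  have "Re (herm_prod (column i U) (M *v column i U)) = d i"
    by (simp add: eig one)
  then show "column i U \<bullet> (M *v column i U) = d i"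
    by (simp add: Re_herm_prod)
qed

lemma hermitian_spectral_decomposition:
  fixes M :: "complex^'a^'a"
  assumes "hermitian M"
  obtains U d where "unitary U" "M = U ** real_diag d ** conjtr U"
proof -
  obtain u :: "'a \<Rightarrow> complex^'a" and d :: "'a \<Rightarrow> real"
    where orth: "\<And>i j. herm_prod (u i) (u j) = (if i = j then 1 else 0)"
    and eig: "\<And>i. M *v u i = complex_of_real (d i) *s u i"
    using orthonormal_eigenvectors[OF assms, of UNIV] by (metis UNIV_I)
  define U where "U = (\<chi> i j. u j $ i)"
  have UU: "conjtr U ** U = mat 1"
    using orth by (simp add: vec_eq_iff U_def matrix_matrix_mult_def herm_prod_def mat_def)
  then have UU': "U ** conjtr U = mat 1"
    using matrix_left_right_inverse by blast
  have "(M ** U) $ i $ j = (M *v u j) $ i" for i j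
    by (simp add: U_def matrix_matrix_mult_def matrix_vector_mult_def)
  then have "M ** U = U ** real_diag d"
    by (simp add: vec_eq_iff eig) (simp add: U_def)
  then have "M = U ** real_diag d ** conjtr U"
    by (metis UU' matrix_mul_assoc matrix_mul_rid)
  then show thesis using that UU UU' by (simp add: unitary_def)
qed

lemma pos_def_spectral_decomposition:
  fixes M :: "complex^'a^'a"
  assumes "pos_def M"
  obtains U d where "unitary U" "\<And>i. 0 < d i" "M = U ** real_diag d ** conjtr U"
proof -
  obtain U d where U: "unitary U" "M = U ** real_diag d ** conjtr U"
    using hermitian_spectral_decomposition assms unfolding pos_def_def by blast
  have "0 < d i" for i
  proof -
    have "column i U \<noteq> 0"
      using column_quad_form(2)[OF U, of i] by auto
    then show ?thesis
      using assms column_quad_form(1)[OF U, of i] by (metis Re_quad_form pos_def_def)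
  qed
  then show thesis using that U by blast
qed

section \<open>The logarithm of a positive definite matrix\<close>

text \<open>
  If two decompositions \<open>U D U\<^sup>*\<close> and \<open>V E V\<^sup>*\<close> agree, the matrix \<open>P = V\<^sup>* U\<close> intertwines \<open>D\<close> and \<open>E\<close>.
  Entrywise, \<open>P\<close> can be nonzero only where the eigenvalues agree, so that it also intertwines
  any function of \<open>D\<close> with the same function of \<open>E\<close>.
\<close>
lemma spectral_function_unique:
  fixes U V :: "complex^'a^'a"
  assumes "unitary U" "unitary V"
    and eq: "U ** real_diag d ** conjtr U = V ** real_diag e ** conjtr V"
  shows "U ** real_diag (\<lambda>i. f (d i)) ** conjtr U = V ** real_diag (\<lambda>i. f (e i)) ** conjtr V"
proof -
  have U: "U ** conjtr U = mat 1" "conjtr U ** U = mat 1"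
    and V: "V ** conjtr V = mat 1" "conjtr V ** V = mat 1"
    using assms by (auto simp: unitary_def)
  define P where "P = conjtr V ** U"
  have "P ** real_diag d = conjtr V ** (U ** real_diag d ** conjtr U) ** U"
    unfolding P_def by (simp add: U flip: matrix_mul_assoc)
  also have "\<dots> = real_diag e ** P"
    unfolding P_def eq by (simp add: V matrix_mul_assoc)
  finally have "P $ i $ j * complex_of_real (d j) = complex_of_real (e i) * P $ i $ j" for i j
    by (metis mult_real_diag_nth)
  then have "P $ i $ j * (complex_of_real (d j) - complex_of_real (e i)) = 0" for i j
    by (simp add: right_diff_distrib mult.commute)
  then have zero: "P $ i $ j = 0 \<or> d j = e i" for i j
    by simp
  have "P $ i $ j * complex_of_real (f (d j)) = complex_of_real (f (e i)) * P $ i $ j" for i j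
    using zero[of i j] by auto
  then have "P ** real_diag (\<lambda>i. f (d i)) = real_diag (\<lambda>i. f (e i)) ** P"
    by (simp add: vec_eq_iff)
  then have "V ** (P ** real_diag (\<lambda>i. f (d i))) ** conjtr U
      = V ** (real_diag (\<lambda>i. f (e i)) ** P) ** conjtr U" by simp
  then have "(V ** conjtr V) ** U ** real_diag (\<lambda>i. f (d i)) ** conjtr U
      = V ** real_diag (\<lambda>i. f (e i)) ** conjtr V ** (U ** conjtr U)"
    by (simp add: P_def matrix_mul_assoc)
  then show ?thesis by (simp add: U V)
qed

lemma mat_log_spectral:
  assumes "unitary U" "\<And>i. 0 < d i"
  shows "mat_log (U ** real_diag d ** conjtr U) = U ** real_diag (\<lambda>i. ln (d i)) ** conjtr U"
  unfolding mat_log_def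
proof (rule the_equality)
  fix X
  assume "\<exists>V e. unitary V \<and> (\<forall>i. 0 < e i) \<and>
      U ** real_diag d ** conjtr U = V ** real_diag e ** conjtr V \<and>
      X = V ** real_diag (\<lambda>i. ln (e i)) ** conjtr V"
  then show "X = U ** real_diag (\<lambda>i. ln (d i)) ** conjtr U"
    using spectral_function_unique[OF assms(1), of _ d _ ln] by metis
qed (use assms in blast)

lemma mat_log_1: "mat_log (mat 1 :: complex^'a^'a) = 0"
proof -
  have "real_diag (\<lambda>_. 1) = (mat 1 :: complex^'a^'a)" "real_diag (\<lambda>_. 0) = (0 :: complex^'a^'a)"
    by (simp_all add: real_diag_def mat_def vec_eq_iff)
  moreover have "mat_log (mat 1 ** real_diag (\<lambda>_. 1) ** conjtr (mat 1) :: complex^'a^'a)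
      = mat 1 ** real_diag (\<lambda>_. ln 1) ** conjtr (mat 1)"
    by (rule mat_log_spectral) (simp_all add: unitary_def)
  ultimately show ?thesis by simp
qed

lemma trace_mat_log:
  assumes "pos_def M"
  shows "0 < Re (det M)" "det M = complex_of_real (Re (det M))"
    "Re (trace (mat_log M)) = ln (Re (det M))"
proof -
  obtain U d where U: "unitary U" and d: "\<And>i. 0 < d i"
    and M: "M = U ** real_diag d ** conjtr U"
    using pos_def_spectral_decomposition[OF assms] by metis
  have "det U * det (conjtr U) = 1"
    using U by (metis det_I det_mul unitary_def)
  then have "det M = det (real_diag d)"
    by (simp add: M det_mul mult_ac)
  also have "\<dots> = (\<Prod>i\<in>UNIV. complex_of_real (d i))"
    by (subst det_diagonal) (simp_all add: real_diag_def)
  finally have det: "det M = complex_of_real (\<Prod>i\<in>UNIV. d i)" by simp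
  have "trace (mat_log M) = trace (conjtr U ** (U ** real_diag (\<lambda>i. ln (d i))))"
    unfolding M mat_log_spectral[OF U d] by (rule trace_mul_sym)
  also have "\<dots> = trace (real_diag (\<lambda>i. ln (d i)) :: complex^'a^'a)"
    using U by (simp add: matrix_mul_assoc unitary_def)
  also have "\<dots> = complex_of_real (\<Sum>i\<in>UNIV. ln (d i))"
    by (simp add: trace_def real_diag_def)
  also have "(\<Sum>i\<in>UNIV. ln (d i)) = ln (\<Prod>i\<in>UNIV. d i)"
    using d by (simp add: ln_prod less_imp_neq[THEN not_sym])
  finally show "Re (trace (mat_log M)) = ln (Re (det M))"
    by (simp only: det Re_complex_of_real)
  show "0 < Re (det M)" "det M = complex_of_real (Re (det M))"
    unfolding det Re_complex_of_real using d by (simp_all add: prod_pos)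
qed

section \<open>Continuity\<close>

lemma continuous_on_matrix_mult [continuous_intros]:
  fixes f :: "'c::topological_space \<Rightarrow> complex^'a^'b"
  assumes "continuous_on S f" "continuous_on S g"
  shows "continuous_on S (\<lambda>x. f x ** g x)"
  unfolding matrix_matrix_mult_def by (intro continuous_intros assms)

lemma continuous_on_conjtr [continuous_intros]:
  assumes "continuous_on S f"
  shows "continuous_on S (\<lambda>x. conjtr (f x))"
  unfolding conjtr_def transpose_def map_matrix_def
  by (simp, intro continuous_intros assms)

lemma continuous_on_real_diag [continuous_intros]:
  assumes "\<And>i. continuous_on S (\<lambda>x. d x i)"
  shows "continuous_on S (\<lambda>x. real_diag (d x))"
  unfolding real_diag_def
proof (intro continuous_on_vec_lambda)
  fix i j
  show "continuous_on S (\<lambda>x. if i = j then complex_of_real (d x i) else 0)"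
    by (cases "i = j") (auto intro!: continuous_intros assms)
qed

lemma continuous_on_det [continuous_intros]:
  fixes f :: "'c::topological_space \<Rightarrow> complex^'a^'a"
  assumes "continuous_on S f"
  shows "continuous_on S (\<lambda>x. det (f x))"
  unfolding det_def by (intro continuous_intros assms)

text \<open>By Cramer's rule, the entries of the inverse are quotients of determinants.\<close>
lemma continuous_on_matrix_inv:
  fixes f :: "'c::topological_space \<Rightarrow> complex^'a^'a"
  assumes cont: "continuous_on S f" and inv: "\<And>x. x \<in> S \<Longrightarrow> invertible (f x)"
  shows "continuous_on S (\<lambda>x. matrix_inv (f x))"
proof -
  define c where "c x = (\<chi> i j. det (\<chi> r s. if s = i then axis j 1 $ r else f x $ r $ s) / det (f x))"
    for x
  have "continuous_on S c"
    unfolding c_def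
  proof (intro continuous_intros continuous_on_vec_lambda cont)
    fix i j r s
    show "continuous_on S (\<lambda>x. if s = i then axis j 1 $ r else f x $ r $ s)"
      by (cases "s = i") (auto intro!: continuous_intros cont)
  qed (use inv invertible_det_nz in blast)
  moreover have "matrix_inv (f x) = c x" if "x \<in> S" for x
  proof (rule matrix_inv_eqI)
    have "f x *v column j (c x) = axis j 1" for j
      using inv[OF that] by (subst cramer) (simp_all add: invertible_det_nz c_def column_def)
    moreover have "(f x ** c x) $ i $ j = (f x *v column j (c x)) $ i" for i j
      by (simp add: matrix_matrix_mult_def matrix_vector_mult_def column_def)
    ultimately show "f x ** c x = mat 1"
      by (simp add: vec_eq_iff mat_def axis_def)
  qed
  ultimately show ?thesis by (simp cong: continuous_on_cong)
qed

lemma compact_unitary: "compact {U :: complex^'a^'a. unitary U}"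
proof -
  have "norm U = sqrt (real CARD('a))" if "unitary U" for U :: "complex^'a^'a"
  proof -
    have "U \<bullet> U = Re (trace (U ** conjtr U))"
      by (simp add: inner_vec_def inner_complex_def trace_def matrix_matrix_mult_def)
    also have "\<dots> = real CARD('a)"
      using that by (simp add: unitary_def trace_I)
    finally show ?thesis by (simp add: norm_eq_sqrt_inner)
  qed
  then have "bounded {U :: complex^'a^'a. unitary U}"
    by (intro boundedI[of _ "sqrt (real CARD('a))"]) simp
  moreover have "closed {U :: complex^'a^'a. unitary U}"
    unfolding unitary_def
    by (intro closed_Collect_conj closed_Collect_eq continuous_intros)
  ultimately show ?thesis by (simp add: compact_eq_bounded_closed)
qed

text \<open>
  The matrices with spectrum in \<open>[a, b]\<close> are the continuous image of the compact set of pairs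
  \<open>(U, d)\<close>, hence carry the quotient topology. In terms of these pairs the logarithm is
  visibly continuous.
\<close>
lemma continuous_on_mat_log_bounded:
  fixes a b :: real
  assumes "0 < a"
  defines "K \<equiv> {U :: complex^'a^'a. unitary U} \<times> cbox (\<chi> i. a) (\<chi> i. b)"
  defines "q \<equiv> \<lambda>(U, d). U ** real_diag (($) d) ** conjtr U"
  shows "continuous_on (q ` K) mat_log"
proof -
  have K: "compact K"
    unfolding K_def by (intro compact_Times compact_unitary compact_cbox)
  have pos: "0 < d $ i" if "(U, d) \<in> K" for U d i
    using that assms(1) by (force simp: K_def mem_box_cart intro: less_le_trans)
  have q: "continuous_on K q"
    unfolding q_def case_prod_beta by (intro continuous_intros)
  have "continuous_on K (\<lambda>p. fst p ** real_diag (\<lambda>i. ln (snd p $ i)) ** conjtr (fst p))"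
    using pos by (intro continuous_intros) (auto simp: less_imp_neq[THEN not_sym])
  moreover have "mat_log (q p) = fst p ** real_diag (\<lambda>i. ln (snd p $ i)) ** conjtr (fst p)"
    if "p \<in> K" for p
    using that pos by (cases p) (auto simp: q_def K_def intro!: mat_log_spectral)
  ultimately have log: "continuous_on K (\<lambda>p. mat_log (q p))"
    by (simp cong: continuous_on_cong)
  have "closed (mat_log -` C \<inter> q ` K)" if "closed C" for C
  proof -
    have "mat_log -` C \<inter> q ` K = q ` ((\<lambda>p. mat_log (q p)) -` C \<inter> K)" by auto
    moreover have "closed ((\<lambda>p. mat_log (q p)) -` C \<inter> K)"
      using closed_vimage_Int[OF that log] K compact_imp_closed by blast
    then have "compact ((\<lambda>p. mat_log (q p)) -` C \<inter> K)"
      using K by (metis Int_assoc Int_absorb closed_Int_compact)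
    ultimately show ?thesis
      by (metis Int_lower2 compact_continuous_image compact_imp_closed continuous_on_subset q)
  qed
  then show ?thesis
    using compact_imp_closed[OF compact_continuous_image[OF q K]]
    by (simp add: continuous_on_closed_vimage)
qed

text \<open>
  On a compact set, the eigenvalues of a continuous positive definite function stay in some
  interval \<open>[a, b]\<close> with \<open>a > 0\<close>, since its quadratic form is continuous on a compact set of
  unit vectors.
\<close>
lemma continuous_on_mat_log:
  fixes F :: "'c::topological_space \<Rightarrow> complex^'a^'a"
  assumes "compact S" and cont: "continuous_on S F" and pos: "\<And>z. z \<in> S \<Longrightarrow> pos_def (F z)"
  shows "continuous_on S (\<lambda>z. mat_log (F z))"
proof (cases "S = {}")
  case False
  let ?X = "S \<times> sphere (0 :: complex^'a) 1"
  let ?h = "\<lambda>p. snd p \<bullet> (F (fst p) *v snd p)"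
  have X: "compact ?X" using assms(1) by (simp add: compact_Times)
  have "axis undefined 1 \<in> sphere (0 :: complex^'a) 1" by simp
  then have ne: "?X \<noteq> {}" using False by blast
  have F: "continuous_on ?X (\<lambda>p. F (fst p))"
    by (rule continuous_on_compose2[OF cont]) (auto intro: continuous_intros)
  have h: "continuous_on ?X ?h"
    unfolding matrix_vector_mult_def by (intro continuous_intros F)
  obtain p where p: "p \<in> ?X" "\<And>x. x \<in> ?X \<Longrightarrow> ?h p \<le> ?h x"
    using continuous_attains_inf[OF X ne h] by blast
  obtain r where r: "r \<in> ?X" "\<And>x. x \<in> ?X \<Longrightarrow> ?h x \<le> ?h r"
    using continuous_attains_sup[OF X ne h] by blast
  have "snd p \<noteq> 0" using p(1) by auto
  then have a: "0 < ?h p"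
    using pos[of "fst p"] p(1) by (auto simp: pos_def_def Re_quad_form)
  let ?Q = "(\<lambda>(U, d). U ** real_diag (($) d) ** conjtr U) `
    ({U :: complex^'a^'a. unitary U} \<times> cbox (\<chi> i. ?h p) (\<chi> i. ?h r))"
  have "F z \<in> ?Q" if z: "z \<in> S" for z
  proof -
    obtain U d where U: "unitary U" "F z = U ** real_diag d ** conjtr U"
      using pos_def_spectral_decomposition[OF pos[OF z]] by metis
    have "?h p \<le> d i \<and> d i \<le> ?h r" for i
      using p(2)[of "(z, column i U)"] r(2)[of "(z, column i U)"] z column_quad_form[OF U, of i]
      by simp
    then have "(U, \<chi> i. d i) \<in> {U. unitary U} \<times> cbox (\<chi> i. ?h p) (\<chi> i. ?h r)"
      using U by (simp add: mem_box_cart)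
    moreover have "($) (\<chi> i. d i) = d" by (rule ext) simp
    then have "F z = (case (U, \<chi> i. d i) of (U, d) \<Rightarrow> U ** real_diag (($) d) ** conjtr U)"
      using U(2) by simp
    ultimately show ?thesis by (rule rev_image_eqI)
  qed
  then show ?thesis
    by (intro continuous_on_compose2[OF continuous_on_mat_log_bounded[OF a] cont]) auto
qed simp

lemma mat_mult_nth: "(mat c ** M) $ i $ j = c * M $ i $ j"
proof -
  have "(mat c ** M) $ i $ j = (\<Sum>k\<in>UNIV. (if i = k then c else 0) * M $ k $ j)"
    by (simp add: matrix_matrix_mult_def mat_def)
  also have "\<dots> = (\<Sum>k\<in>UNIV. if i = k then c * M $ k $ j else 0)"
    by (intro sum.cong) auto
  finally show ?thesis by simp
qed

lemma continuous_on_matrix_componentwise: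
  fixes F :: "'c::topological_space \<Rightarrow> complex^'a^'b"
  assumes "\<And>i j. continuous_on S (\<lambda>z. F z $ i $ j)"
  shows "continuous_on S F"
proof -
  have "continuous_on S (\<lambda>z. \<chi> i j. F z $ i $ j)"
    by (intro continuous_on_vec_lambda assms)
  then show ?thesis by (simp add: vec_lambda_eta)
qed

lemma continuous_on_stable_causal:
  assumes "stable_causal F"
  shows "continuous_on (sphere 0 1) F"
proof (rule continuous_on_matrix_componentwise)
  fix i j
  obtain h where h: "summable (\<lambda>k. norm (h k))"
    and sums: "\<And>z. z \<in> sphere 0 1 \<Longrightarrow> (\<lambda>k. mat (inverse z ^ k) ** cmat (h k)) sums F z"
    using assms unfolding stable_causal_def by blast
  let ?g = "\<lambda>k z. inverse z ^ k * complex_of_real (h k $ i $ j)"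
  have "\<bar>h k $ i $ j\<bar> \<le> norm (h k)" for k
    by (rule order_trans[OF component_le_norm_cart Finite_Cartesian_Product.norm_nth_le])
  then have "norm (?g k z) \<le> norm (h k)" if "z \<in> sphere 0 1" for k z
    using that by (simp add: norm_mult norm_power norm_inverse)
  then have "uniform_limit (sphere 0 1) (\<lambda>n z. \<Sum>k<n. ?g k z) (\<lambda>z. \<Sum>k. ?g k z) sequentially"
    using h by (rule Weierstrass_m_test)
  moreover have "continuous_on (sphere 0 1) (\<lambda>z. \<Sum>k<n. ?g k z)" for n
    by (intro continuous_intros) auto
  ultimately have "continuous_on (sphere 0 1) (\<lambda>z. \<Sum>k. ?g k z)"
    by (intro uniform_limit_theorem[OF always_eventually]) auto
  moreover have "(\<Sum>k. ?g k z) = F z $ i $ j" if "z \<in> sphere 0 1" for z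
  proof -
    have "bounded_linear (\<lambda>M :: complex^'a^'a. M $ i $ j)"
      by (simp add: bounded_linear_vec_nth bounded_linear_compose[of "\<lambda>x. x $ j"])
    from bounded_linear.sums[OF this sums[OF that]] show ?thesis
      by (simp add: mat_mult_nth sums_unique[symmetric])
  qed
  ultimately show "continuous_on (sphere 0 1) (\<lambda>z. F z $ i $ j)"
    by (rule continuous_on_eq)
qed

text \<open>The resolvent has no pole on the unit circle because the spectral radius is below one.\<close>
lemma continuous_on_filter_bank:
  assumes "schur_stable A"
  shows "continuous_on (sphere 0 1) (filter_bank A B)"
proof -
  have "invertible (mat z - cmat A)" if "z \<in> sphere 0 1" for z
    unfolding invertible_left_inverse matrix_left_invertible_ker
  proof (intro allI impI)
    fix v assume "(mat z - cmat A) *v v = 0"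
    moreover have "mat z *v v = z *s v"
      by (simp add: vec_eq_iff matrix_vector_mult_def mat_def if_distribR if_distrib sum.delta
          cong: if_cong)
    ultimately have "cmat A *v v = z *s v"
      by (simp add: matrix_vector_mult_diff_rdistrib)
    then show "v = 0"
      using assms that unfolding schur_stable_def by force
  qed
  moreover have "continuous_on (sphere 0 1) (\<lambda>z. mat z - cmat A)"
  proof (rule continuous_on_matrix_componentwise)
    fix i j
    show "continuous_on (sphere 0 1) (\<lambda>z. (mat z - cmat A) $ i $ j)"
      by (cases "i = j") (auto simp: mat_def intro!: continuous_intros)
  qed
  ultimately have "continuous_on (sphere 0 1) (\<lambda>z. matrix_inv (mat z - cmat A) ** cmat B)"
    by (intro continuous_on_matrix_mult continuous_on_matrix_inv continuous_on_const) auto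
  then show ?thesis
    by (simp add: filter_bank_def[abs_def])
qed

lemma continuous_on_correlogram: "continuous_on (sphere 0 1) (correlogram N M w y)"
proof (rule continuous_on_matrix_componentwise)
  fix i j
  show "continuous_on (sphere 0 1) (\<lambda>z. correlogram N M w y z $ i $ j)"
    unfolding correlogram_def
    by (simp add: mat_mult_nth) (intro continuous_intros, auto)
qed

section \<open>Integrals over the circle\<close>

lemma set_integrable_circle:
  fixes f :: "complex \<Rightarrow> 'b::euclidean_space"
  assumes "continuous_on (sphere 0 1) f"
  shows "set_integrable lborel {-pi..pi} (\<lambda>\<theta>. f (cis \<theta>))"
  by (intro borel_integrable_atLeastAtMost' continuous_on_compose2[OF assms]) 
    (auto intro: continuous_intros)

lemma linear_circle_integral:
  fixes F :: "complex \<Rightarrow> complex^'a^'b" and T :: "complex^'a^'b \<Rightarrow> real"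
  assumes "linear T" and "continuous_on (sphere 0 1) F"
  shows "T (circle_integral F) = (1 / (2 * pi)) * (LINT \<theta>:{-pi..pi}|lborel. T (F (cis \<theta>)))"
proof -
  have T: "bounded_linear T"
    using assms(1) by (simp add: linear_conv_bounded_linear)
  have "T (LINT \<theta>:{-pi..pi}|lborel. F (cis \<theta>)) = (LINT \<theta>:{-pi..pi}|lborel. T (F (cis \<theta>)))"
    using integral_bounded_linear[OF T set_integrable_circle[OF assms(2), unfolded set_integrable_def]]
    by (simp add: set_lebesgue_integral_def linear_cmul[OF assms(1)])
  then show ?thesis
    by (simp add: circle_integral_def linear_cmul[OF assms(1)])
qed

lemma linear_Re_trace_mult:
  fixes N :: "complex^'a^'b"
  shows "linear (\<lambda>M :: complex^'b^'a. Re (trace (M ** N)))"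
  by (rule linearI) (simp_all add: trace_def matrix_matrix_mult_def distrib_right sum.distrib
      sum_distrib_left sum_subtractf algebra_simps)

section \<open>The pointwise identity\<close>

lemma model_inverse:
  fixes W H :: "complex^'a^'a"
  assumes W: "invertible W" and inv: "invertible (mat 1 + conjtr W ** H ** W)"
  defines "T \<equiv> W ** matrix_inv (mat 1 + conjtr W ** H ** W) ** conjtr W"
  shows "(matrix_inv (W ** conjtr W) + H) ** T = mat 1"
proof -
  let ?R = "mat 1 + conjtr W ** H ** W"
  have W1: "W ** matrix_inv W = mat 1" "matrix_inv W ** W = mat 1"
    using matrix_inv_right_left[OF W] .
  then have W2: "conjtr (matrix_inv W) ** conjtr W = mat 1" "conjtr W ** conjtr (matrix_inv W) = mat 1"
    by (simp_all flip: conjtr_mult)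
  have "W ** conjtr W ** (conjtr (matrix_inv W) ** matrix_inv W) = 
      W ** (conjtr W ** conjtr (matrix_inv W)) ** matrix_inv W"
    by (simp add: matrix_mul_assoc)
  then have "matrix_inv (W ** conjtr W) = conjtr (matrix_inv W) ** matrix_inv W"
    by (intro matrix_inv_eqI) (simp add: W1 W2)
  also have "\<dots> + H = conjtr (matrix_inv W) ** ?R ** matrix_inv W"
  proof -
    have "conjtr (matrix_inv W) ** (conjtr W ** H ** W) ** matrix_inv W
        = (conjtr (matrix_inv W) ** conjtr W) ** H ** (W ** matrix_inv W)"
      by (simp add: matrix_mul_assoc)
    then show ?thesis
      by (simp add: W1 W2 matrix_add_ldistrib matrix_add_rdistrib)
  qed
  finally have "(matrix_inv (W ** conjtr W) + H) ** T
      = conjtr (matrix_inv W) ** ?R ** (matrix_inv W ** W) ** matrix_inv ?R ** conjtr W"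
    by (simp add: T_def matrix_mul_assoc)
  also have "\<dots> = conjtr (matrix_inv W) ** (?R ** matrix_inv ?R) ** conjtr W"
    by (simp add: W1 matrix_mul_assoc)
  finally show ?thesis
    by (simp add: matrix_inv_right_left[OF inv] W2)
qed

text \<open>
  The determinants satisfy \<open>det \<Lambda> det T = det \<Omega>\<close>, and \<open>tr \<Lambda> = tr (\<Omega> T\<^sup>-\<^sup>1)\<close> by cyclicity of the trace.
\<close>
lemma prediction_error_identity:
  fixes L T X \<Omega> :: "complex^'a^'a"
  assumes \<Omega>: "pos_def \<Omega>" and XT: "X ** T = mat 1" and T: "T = L ** conjtr L"
  defines "\<Lambda> \<equiv> matrix_inv L ** \<Omega> ** conjtr (matrix_inv L)"
  shows "pos_def T" "pos_def \<Lambda>" 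
    "Re (trace \<Lambda>) - Re (trace (mat_log \<Lambda>))
      = Re (trace (\<Omega> ** X)) - Re (trace (mat_log \<Omega>)) + Re (trace (mat_log T))"
proof -
  have "invertible T"
    using XT invertible_left_inverse by blast
  then have L: "invertible L"
    unfolding T by (rule invertible_of_mult)
  show posT: "pos_def T"
    using pos_def_congruence[OF pos_def_mat_1 L] by (simp add: T)
  have L1: "L ** matrix_inv L = mat 1" "matrix_inv L ** L = mat 1"
    using matrix_inv_right_left[OF L] .
  then have L2: "conjtr (matrix_inv L) ** conjtr L = mat 1" "conjtr L ** conjtr (matrix_inv L) = mat 1"
    by (simp_all flip: conjtr_mult)
  have "invertible (matrix_inv L)"
    using L1 unfolding invertible_def by blast
  then show pos: "pos_def \<Lambda>"
    unfolding \<Lambda>_def by (rule pos_def_congruence[OF \<Omega>])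
  have "T ** (conjtr (matrix_inv L) ** matrix_inv L) = L ** (conjtr L ** conjtr (matrix_inv L)) ** matrix_inv L"
    by (simp add: T matrix_mul_assoc)
  then have "T ** (conjtr (matrix_inv L) ** matrix_inv L) = mat 1"
    by (simp add: L1 L2)
  then have "X = conjtr (matrix_inv L) ** matrix_inv L"
    by (metis XT matrix_mul_assoc matrix_mul_lid matrix_mul_rid)
  then have tr: "trace \<Lambda> = trace (\<Omega> ** X)"
    using trace_mul_sym[of "matrix_inv L" "\<Omega> ** conjtr (matrix_inv L)"]
    by (simp add: \<Lambda>_def matrix_mul_assoc)
  have "\<Lambda> ** conjtr L = matrix_inv L ** \<Omega>"
    by (simp add: \<Lambda>_def L2 flip: matrix_mul_assoc)
  then have "L ** (\<Lambda> ** conjtr L) = \<Omega>"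
    by (simp add: L1 matrix_mul_assoc)
  then have "det \<Omega> = det T * det \<Lambda>"
    by (metis T det_mul mult.assoc mult.commute)
  then have "complex_of_real (Re (det \<Omega>)) = complex_of_real (Re (det T) * Re (det \<Lambda>))"
    using trace_mat_log(2)[OF \<Omega>] trace_mat_log(2)[OF pos] trace_mat_log(2)[OF posT] by simp
  then have det: "Re (det \<Omega>) = Re (det T) * Re (det \<Lambda>)"
    by (simp only: of_real_eq_iff)
  have "Re (trace (mat_log \<Omega>)) = Re (trace (mat_log T)) + Re (trace (mat_log \<Lambda>))"
    unfolding trace_mat_log(3)[OF \<Omega>] trace_mat_log(3)[OF pos] trace_mat_log(3)[OF posT] det
    using trace_mat_log(1)[OF pos] trace_mat_log(1)[OF posT] by (simp add: ln_mult)
  then show "Re (trace \<Lambda>) - Re (trace (mat_log \<Lambda>))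
      = Re (trace (\<Omega> ** X)) - Re (trace (mat_log \<Omega>)) + Re (trace (mat_log T))"
    by (simp add: tr)
qed

lemma S_plus_pos_def:
  assumes "\<Psi> \<in> S_plus" "z \<in> sphere 0 1"
  shows "pos_def (\<Psi> z)"
proof -
  obtain k where k: "0 < k" "loewner_le (cmat (mat k)) (\<Psi> z)" and herm: "hermitian (\<Psi> z)"
    using assms unfolding S_plus_def pos_semidef_def by blast
  have kx: "cmat (mat k) *v x = k *\<^sub>R x" for x
    by (simp add: vec_eq_iff matrix_vector_mult_def mat_def if_distribR if_distrib sum.delta
        cong: if_cong) (simp add: scaleR_conv_of_real)
  have "0 < x \<bullet> (\<Psi> z *v x)" if "x \<noteq> 0" for x
  proof -
    have "0 < k * (x \<bullet> x)" using that k by simp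
    also have "\<dots> \<le> x \<bullet> (\<Psi> z *v x)"
      using k(2) by (simp add: loewner_le_def pos_semidef_def Re_quad_form
          matrix_vector_mult_diff_rdistrib inner_diff_right kx)
    finally show ?thesis .
  qed
  then show ?thesis using herm by (simp add: pos_def_def Re_quad_form)
qed

section \<open>Prediction error identification and the dual problem\<close>

text \<open>
  Continuity of the integrands \<open>f\<close>, \<open>g1\<close> and \<open>g2\<close> on the circle is what allows the trace to be moved
  inside the integrals and the integrals to be combined. The remaining integrand, which does not
  involve \<open>\<Theta>\<close>, is integrable as their combination \<open>f - g1 - g2\<close>.
\<close>
lemma itakura_saito_eq_dual_cost:
  fixes G :: "complex \<Rightarrow> complex^'m^'n" and \<Psi> W \<Omega> :: "complex \<Rightarrow> complex^'m^'m"
  assumes G: "continuous_on (sphere 0 1) G"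
    and \<Psi>: "\<And>z. z \<in> sphere 0 1 \<Longrightarrow> pos_def (\<Psi> z)"
    and W: "left_spectral_factor W \<Psi>"
    and \<Omega>: "continuous_on (sphere 0 1) \<Omega>" "\<And>z. z \<in> sphere 0 1 \<Longrightarrow> pos_def (\<Omega> z)"
    and \<Theta>: "\<Theta> \<in> D_T G W"
    and L: "shaping_filter L (T_model G W \<Theta>)"
  shows "itakura_saito (pred_error_density L \<Omega>) (\<lambda>_. mat 1)
    = dual_cost G \<Psi> (state_cov G \<Omega>) \<Theta> + 1 / (2 * pi) * (LINT \<theta>:{-pi..pi}|lborel.
        Re (trace (\<Omega> (cis \<theta>) ** matrix_inv (\<Psi> (cis \<theta>))))
        - Re (trace (mat_log (\<Omega> (cis \<theta>)))) - real CARD('m))"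
proof -
  let ?C = "sphere (0 :: complex) 1"
  define H where "H z = conjtr (G z) ** cmat \<Theta> ** G z" for z
  define X where "X z = matrix_inv (\<Psi> z) + H z" for z
  define T where "T = T_model G W \<Theta>"
  define \<Lambda> where "\<Lambda> = pred_error_density L \<Omega>"
  have T: "T z = L z ** conjtr (L z)" if "z \<in> ?C" for z
    using L that by (simp add: shaping_filter_def left_spectral_factor_def T_def)
  have XT: "X z ** T z = mat 1" if z: "z \<in> ?C" for z
  proof -
    have \<Psi>W: "\<Psi> z = W z ** conjtr (W z)"
      using W z by (simp add: left_spectral_factor_def)
    have R: "conjtr (W z) ** conjtr (G z) ** cmat \<Theta> ** G z ** W z = conjtr (W z) ** H z ** W z"
      by (simp add: H_def matrix_mul_assoc)
    have "invertible (W z)"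
      using pos_def_invertible[OF \<Psi>[OF z]] unfolding \<Psi>W by (rule invertible_of_mult)
    moreover have "pos_def (mat 1 + conjtr (W z) ** conjtr (G z) ** cmat \<Theta> ** G z ** W z)"
      using \<Theta> z by (simp add: D_T_def)
    then have "invertible (mat 1 + conjtr (W z) ** H z ** W z)"
      unfolding R by (rule pos_def_invertible)
    ultimately show ?thesis
      using model_inverse[of "W z" "H z"] by (simp add: X_def T_def T_model_def \<Psi>W R)
  qed
  have \<Lambda>: "\<Lambda> z = matrix_inv (L z) ** \<Omega> z ** conjtr (matrix_inv (L z))" for z
    by (simp add: \<Lambda>_def pred_error_density_def)
  have identity: "pos_def (T z)" "pos_def (\<Lambda> z)"
    "Re (trace (\<Lambda> z)) - Re (trace (mat_log (\<Lambda> z)))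
      = Re (trace (\<Omega> z ** X z)) - Re (trace (mat_log (\<Omega> z))) + Re (trace (mat_log (T z)))"
    if "z \<in> ?C" for z
    using prediction_error_identity[OF \<Omega>(2)[OF that] XT[OF that] T[OF that], folded \<Lambda>] .

  have cL: "continuous_on ?C L" "continuous_on ?C (\<lambda>z. matrix_inv (L z))"
    using L by (auto simp: shaping_filter_def intro: continuous_on_stable_causal)
  have "continuous_on ?C (\<lambda>z. L z ** conjtr (L z))"
    by (intro continuous_intros cL)
  then have cT: "continuous_on ?C T"
    by (rule continuous_on_eq) (simp add: T)
  have c\<Lambda>: "continuous_on ?C \<Lambda>"
    unfolding \<Lambda>[abs_def] by (intro continuous_intros cL \<Omega>)
  have clogT: "continuous_on ?C (\<lambda>z. mat_log (T z))"
    by (intro continuous_on_mat_log cT identity) auto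
  have clog\<Lambda>: "continuous_on ?C (\<lambda>z. mat_log (\<Lambda> z))"
    by (intro continuous_on_mat_log c\<Lambda> identity) auto

  define f where "f z = Re (trace (\<Lambda> z)) - Re (trace (mat_log (\<Lambda> z))) - real CARD('m)" for z
  define g1 where "g1 z = Re (trace (mat_log (T z)))" for z
  define g2 where "g2 z = Re (trace (G z ** \<Omega> z ** conjtr (G z) ** cmat \<Theta>))" for z
  have lin: "linear (\<lambda>M :: complex^'m^'m. Re (trace M))"
    using linear_Re_trace_mult[of "mat 1"] by simp
  have tr_cont: "continuous_on ?C (\<lambda>z. Re (trace (F z)))"
    if "continuous_on ?C F" for F :: "complex \<Rightarrow> complex^'k^'k"
    unfolding trace_def by (intro continuous_intros that)

  have inv1: "matrix_inv (mat 1 :: complex^'m^'m) = mat 1"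
    by (rule matrix_inv_eqI) simp
  have "itakura_saito \<Lambda> (\<lambda>_. mat 1)
      = 1 / (2 * pi) * (LINT \<theta>:{-pi..pi}|lborel. Re (trace (- mat_log (\<Lambda> (cis \<theta>)) + \<Lambda> (cis \<theta>) - mat 1)))"
    unfolding itakura_saito_def mat_log_1 inv1 matrix_mul_rid diff_0
    by (rule linear_circle_integral[OF lin]) (intro continuous_intros c\<Lambda> clog\<Lambda>)
  also have "\<dots> = 1 / (2 * pi) * (LINT \<theta>:{-pi..pi}|lborel. f (cis \<theta>))"
    by (simp add: f_def trace_sub trace_add trace_I algebra_simps)
  finally have IS: "itakura_saito \<Lambda> (\<lambda>_. mat 1) = 1 / (2 * pi) * (LINT \<theta>:{-pi..pi}|lborel. f (cis \<theta>))" .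

  have "matrix_inv (matrix_inv (\<Psi> z) + conjtr (G z) ** cmat \<Theta> ** G z) = T z" if "z \<in> ?C" for z
    using matrix_inv_eqI[OF XT[OF that]] by (simp add: X_def H_def)
  then have "circle_integral (\<lambda>z. mat_log (matrix_inv (matrix_inv (\<Psi> z) + conjtr (G z) ** cmat \<Theta> ** G z)))
      = circle_integral (\<lambda>z. mat_log (T z))"
    by (simp add: circle_integral_def)
  then have J1: "Re (trace (circle_integral
      (\<lambda>z. mat_log (matrix_inv (matrix_inv (\<Psi> z) + conjtr (G z) ** cmat \<Theta> ** G z)))))
      = 1 / (2 * pi) * (LINT \<theta>:{-pi..pi}|lborel. g1 (cis \<theta>))"
    using linear_circle_integral[OF lin clogT] by (simp add: g1_def)
  have J2: "Re (trace (state_cov G \<Omega> ** cmat \<Theta>)) = 1 / (2 * pi) * (LINT \<theta>:{-pi..pi}|lborel. g2 (cis \<theta>))"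
    unfolding state_cov_def g2_def
    by (rule linear_circle_integral[OF linear_Re_trace_mult]) (intro continuous_intros G \<Omega>)

  have "f z - g1 z - g2 z
      = Re (trace (\<Omega> z ** matrix_inv (\<Psi> z))) - Re (trace (mat_log (\<Omega> z))) - real CARD('m)"
    if "z \<in> ?C" for z
  proof -
    have "trace (G z ** \<Omega> z ** conjtr (G z) ** cmat \<Theta>) = trace (G z ** (\<Omega> z ** conjtr (G z) ** cmat \<Theta>))"
      by (simp add: matrix_mul_assoc)
    also have "\<dots> = trace (\<Omega> z ** H z)"
      by (subst trace_mul_sym) (simp add: H_def matrix_mul_assoc)
    finally have "g2 z = Re (trace (\<Omega> z ** H z))"
      by (simp add: g2_def)
    then show ?thesis
      using identity(3)[OF that]
      by (simp add: f_def g1_def X_def matrix_add_ldistrib trace_add)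
  qed
  then have "(LINT \<theta>:{-pi..pi}|lborel. Re (trace (\<Omega> (cis \<theta>) ** matrix_inv (\<Psi> (cis \<theta>))))
        - Re (trace (mat_log (\<Omega> (cis \<theta>)))) - real CARD('m))
      = (LINT \<theta>:{-pi..pi}|lborel. f (cis \<theta>) - g1 (cis \<theta>) - g2 (cis \<theta>))"
    (is "?c = _")
    by simp
  also have "\<dots> = (LINT \<theta>:{-pi..pi}|lborel. f (cis \<theta>)) - (LINT \<theta>:{-pi..pi}|lborel. g1 (cis \<theta>))
      - (LINT \<theta>:{-pi..pi}|lborel. g2 (cis \<theta>))"
  proof -
    have "continuous_on ?C f"
      unfolding f_def by (intro continuous_on_diff continuous_on_const tr_cont c\<Lambda> clog\<Lambda>)
    moreover have "continuous_on ?C g1"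
      unfolding g1_def by (intro tr_cont clogT)
    moreover have "continuous_on ?C g2"
      unfolding g2_def by (intro tr_cont continuous_intros G \<Omega>)
    ultimately show ?thesis
      using set_integrable_circle[of f] set_integrable_circle[of g1] set_integrable_circle[of g2] by simp
  qed
  finally have c: "?c = (LINT \<theta>:{-pi..pi}|lborel. f (cis \<theta>)) - (LINT \<theta>:{-pi..pi}|lborel. g1 (cis \<theta>))
      - (LINT \<theta>:{-pi..pi}|lborel. g2 (cis \<theta>))" .
  show ?thesis
    unfolding dual_cost_def J1 J2 IS[unfolded \<Lambda>_def] c by (simp add: diff_divide_distrib)
qed

theorem mainTheorem7:
  fixes A :: "real^'n^'n"
    and B :: "real^'m^'n"
    and G :: "complex \<Rightarrow> complex^'m^'n"
    and \<Psi> W\<^sub>\<Psi> \<Omega> :: "complex \<Rightarrow> complex^'m^'m"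
    and y :: "nat \<Rightarrow> real^'m"
    and N M :: nat
    and w :: "nat \<Rightarrow> real"
    and \<Sigma>' :: "complex^'n^'n"
    and L :: "real^'n^'n \<Rightarrow> complex \<Rightarrow> complex^'m^'m"
    and \<Theta>' :: "real^'n^'n"
  assumes "CARD('m) < CARD('n)"
    and "schur_stable A"
    and "reachable A B"
    and "G = filter_bank A B"
    and "\<Psi> \<in> S_plus" and "rational_on_circle \<Psi>"
    and "left_spectral_factor W\<^sub>\<Psi> \<Psi>"
    and "1 \<le> M" and "M \<le> N" and "w 0 = 1"
    and "\<Omega> = correlogram N M w y"
    and "\<forall>z\<in>sphere 0 1. pos_def (\<Omega> z)"
    and "\<Sigma>' = state_cov G \<Omega>"
    and "\<forall>\<Theta>\<in>D_T G W\<^sub>\<Psi>. shaping_filter (L \<Theta>) (T_model G W\<^sub>\<Psi> \<Theta>)"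
    and "is_arg_min (dual_cost G \<Psi> \<Sigma>') (\<lambda>\<Theta>. \<Theta> \<in> D_T G W\<^sub>\<Psi>) \<Theta>'"
  shows "is_arg_min (\<lambda>\<Theta>. itakura_saito (pred_error_density (L \<Theta>) \<Omega>) (\<lambda>_. mat 1))
           (\<lambda>\<Theta>. \<Theta> \<in> D_T G W\<^sub>\<Psi>) \<Theta>'"
proof -
  let ?IS = "\<lambda>\<Theta>. itakura_saito (pred_error_density (L \<Theta>) \<Omega>) (\<lambda>_. mat 1)"
  have "continuous_on (sphere 0 1) G" "continuous_on (sphere 0 1) \<Omega>"
    using assms by (auto intro: continuous_on_filter_bank continuous_on_correlogram)
  then obtain c where c: "\<And>\<Theta>. \<Theta> \<in> D_T G W\<^sub>\<Psi> \<Longrightarrow> ?IS \<Theta> = dual_cost G \<Psi> \<Sigma>' \<Theta> + c"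
    using itakura_saito_eq_dual_cost[of G \<Psi> W\<^sub>\<Psi> \<Omega>] S_plus_pos_def[OF \<open>\<Psi> \<in> S_plus\<close>] assms by blast
  show ?thesis
    using \<open>is_arg_min (dual_cost G \<Psi> \<Sigma>') (\<lambda>\<Theta>. \<Theta> \<in> D_T G W\<^sub>\<Psi>) \<Theta>'\<close> c
    by (auto simp: is_arg_min_def)
qed

end
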